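(* For every $\delta>0$ there exists $n_0=n_0(\delta)=144/\delta^2$ such that the following holds for every integer $n\geq n_0$. Let $A_1,\ldots,A_n$ be $n$ equivalence relations on a finite set $X$. If $|\ker(A_i)|\geq (3+\delta)n$ for each $i\in[n]$, then $A_1,\ldots,A_n$ contain a rainbow matching.
   Context: For an equivalence relation $A$ on $X$, write $x\sim_A y$ if $x,y$ are equivalent under $A$, and let $[x]_A=\{y\in X: x\sim_A y\}$. The kernel of $A$ is $\ker(A)=\{x\in X: |[x]_A|\geq 2\}$. The relations $A_1,\ldots,A_n$ contain a rainbow matching if there exist $2n$ distinct elements $x_1,y_1,\ldots,x_n,y_n\in X$ with $x_i\sim_{A_i} y_i$ for each $i\in[n]$. *)

theory Defs
  imports Complex_Main
begin

definition equiv_kernel :: "'a set \<Rightarrow> ('a \<times> 'a) set \<Rightarrow> 'a set" where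
  "equiv_kernel X A = {x \<in> X. card {y \<in> X. (x, y) \<in> A} \<ge> 2}"

text \<open>The elements \<open>x 1, y 1, \<dots>, x n, y n\<close> are pairwise distinct iff \<open>x\<close> and \<open>y\<close> are injective on
  \<open>{1..n}\<close> and have disjoint images.\<close>

definition has_rainbow_matching :: "'a set \<Rightarrow> nat \<Rightarrow> (nat \<Rightarrow> ('a \<times> 'a) set) \<Rightarrow> bool" where
  "has_rainbow_matching X n A \<longleftrightarrow>
     (\<exists>x y. (\<forall>i\<in>{1..n}. x i \<in> X \<and> y i \<in> X \<and> (x i, y i) \<in> A i) \<and>
            inj_on x {1..n} \<and> inj_on y {1..n} \<and> x ` {1..n} \<inter> y ` {1..n} = {})"

end

(*
  Take a rainbow matching M of all colours but one. The missing colour c has more than (1 + delta) n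
  kernel vertices outside M, pairwise inequivalent, hence its classes hit about (1 + delta) n of the
  2(n - 1) matched vertices, and about delta n edges of M at both ends. Replacing such an edge by one
  of colour c makes its colour the missing one and leaves free whichever end we choose.
  Iterating, let R be the set of colours reached by these switches. If a hits both ends of the edge
  of c, then c cannot hit the edge of a (otherwise M could be completed), apart from a few collisions
  of the vertices used. So two colours of R hit each other's edges at most twice in total, and some c
  in R has at most about |R| hits inside R. Its remaining hits then cover both ends of about
  delta n edges outside R, so R grows by at least delta n / 2 in each step. The collisions cost
  O(k) in step k and O(1/delta) steps are needed, which is why n must be of order 1/delta^2.
*)

theory Submission
  imports Defs
begin

section \<open>Rainbow matchings and a single switch\<close>

definition ends :: "'a \<times> 'a \<Rightarrow> 'a set" where
  "ends e = {fst e, snd e}"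

definition verts :: "(nat \<Rightarrow> 'a \<times> 'a) \<Rightarrow> nat set \<Rightarrow> 'a set" where
  "verts f D = (\<Union>d\<in>D. ends (f d))"

text \<open>The colour set \<open>D\<close> is a parameter because the argument moves between
  matchings that omit different colours.\<close>

definition rainbow :: "(nat \<Rightarrow> ('a \<times> 'a) set) \<Rightarrow> nat set \<Rightarrow> (nat \<Rightarrow> 'a \<times> 'a) \<Rightarrow> bool" where
  "rainbow A D f \<longleftrightarrow>
     (\<forall>d\<in>D. f d \<in> A d \<and> fst (f d) \<noteq> snd (f d)) \<and>
     (\<forall>d\<in>D. \<forall>d'\<in>D. d \<noteq> d' \<longrightarrow> ends (f d) \<inter> ends (f d') = {})"

lemma ends_pair [simp]: "ends (x, y) = {x, y}"
  by (simp add: ends_def)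

lemma card_ends_le: "card (ends e) \<le> 2"
  by (cases e) (simp add: card_insert_if)

lemma finite_ends [simp]: "finite (ends e)"
  by (simp add: ends_def)

lemma ends_nonempty [simp]: "ends e \<noteq> {}"
  by (simp add: ends_def)

lemma finite_verts: "finite D \<Longrightarrow> finite (verts f D)"
  by (simp add: verts_def)

lemma card_verts_le: "finite D \<Longrightarrow> card (verts f D) \<le> 2 * card D"
  unfolding verts_def
  by (rule order_trans[OF card_UN_le]) (auto intro: order_trans[OF sum_bounded_above[OF card_ends_le]])

lemma rainbow_complete:
  assumes "rainbow A (D - {b}) f" "(x, z) \<in> A b" "x \<noteq> z"
    "x \<notin> verts f (D - {b})" "z \<notin> verts f (D - {b})"
  shows "rainbow A D (f(b := (x, z)))"
  using assms unfolding rainbow_def verts_def by auto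

text \<open>Colour \<open>b\<close> takes over the end \<open>y\<close> of the edge of
  \<open>a\<close>, so \<open>a\<close> becomes the missing colour and \<open>x\<close> is freed;
  \<open>w\<close> is the only vertex gained.\<close>

lemma rainbow_switch:
  assumes f: "rainbow A (D - {b}) f" and "a \<in> D" "a \<noteq> b" and e: "ends (f a) = {x, y}" and "x \<noteq> y"
    and w: "(y, w) \<in> A b" "w \<notin> verts f (D - {b})"
  shows "rainbow A (D - {a}) (f(b := (y, w)))"
    and "verts (f(b := (y, w))) (D - {a}) \<subseteq> insert w (verts f (D - {b}) - {x})"
proof -
  have a: "a \<in> D - {b}" using assms by auto
  have disj: "ends (f a) \<inter> ends (f d) = {}" if "d \<in> D - {a}" "d \<noteq> b" for d
    using f that a unfolding rainbow_def by (metis Diff_iff singletonD singletonI)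
  have yw: "y \<noteq> w" using e w a unfolding verts_def by auto
  have wd: "w \<notin> ends (f d)" if "d \<in> D" "d \<noteq> b" for d
    using w that unfolding verts_def by auto
  have yd: "y \<notin> ends (f d)" "x \<notin> ends (f d)" if "d \<in> D" "d \<noteq> b" "d \<noteq> a" for d
    using disj[of d] e that by auto
  show "rainbow A (D - {a}) (f(b := (y, w)))"
    using f w yw wd yd unfolding rainbow_def by auto
  have "x \<noteq> w" using wd[of a] e \<open>a \<noteq> b\<close> \<open>a \<in> D\<close> by auto
  moreover have "y \<in> verts f (D - {b}) - {x}" using a e \<open>x \<noteq> y\<close> unfolding verts_def by auto
  ultimately show "verts (f(b := (y, w))) (D - {a}) \<subseteq> insert w (verts f (D - {b}) - {x})"
    using yd unfolding verts_def by (auto split: if_splits)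
qed

section \<open>Sequences of switches from a matching that misses one colour\<close>

text \<open>The inductive step set up for contradiction: any way to complete a matching of all of
  \<open>D\<close> yields \<open>False\<close>.\<close>

locale near_matching =
  fixes X :: "'a set" and A :: "nat \<Rightarrow> ('a \<times> 'a) set" and D :: "nat set" and c\<^sub>0 :: nat
    and M :: "nat \<Rightarrow> 'a \<times> 'a"
  assumes finite_X: "finite X" and finite_D: "finite D" and c\<^sub>0: "c\<^sub>0 \<in> D"
    and equiv: "\<And>d. d \<in> D \<Longrightarrow> equiv X (A d)"
    and M: "rainbow A (D - {c\<^sub>0}) M"
    and no_rainbow: "\<And>f. \<not> rainbow A D f"
begin

definition V :: "'a set" where
  "V = verts M (D - {c\<^sub>0})"

lemma ends_subset_V: "a \<in> D \<Longrightarrow> a \<noteq> c\<^sub>0 \<Longrightarrow> ends (M a) \<subseteq> V"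
  unfolding V_def verts_def by auto

lemma obtain_ends:
  assumes "a \<in> D" "a \<noteq> c\<^sub>0" "x \<in> ends (M a)"
  obtains y where "ends (M a) = {x, y}" "x \<noteq> y"
proof -
  have "fst (M a) \<noteq> snd (M a)" using assms M unfolding rainbow_def by auto
  then show thesis using assms(3) that[of "snd (M a)"] that[of "fst (M a)"]
    unfolding ends_def by (auto simp: insert_commute)
qed

lemma finite_V: "finite V"
  unfolding V_def using finite_D by (simp add: finite_verts)

lemma card_V_le: "card V \<le> 2 * (card D - 1)"
  unfolding V_def using card_verts_le[of "D - {c\<^sub>0}" M] finite_D c\<^sub>0 by (simp add: card_Diff_singleton)

text \<open>Outside \<open>P\<close> the edges of \<open>M\<close> are intact and can still be
  switched; \<open>U\<close> bounds the vertices beyond \<open>V\<close> that may be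
  occupied.\<close>

definition moved :: "nat set \<Rightarrow> nat \<Rightarrow> 'a set \<Rightarrow> (nat \<Rightarrow> 'a \<times> 'a) \<Rightarrow> bool" where
  "moved P b U f \<longleftrightarrow> rainbow A (D - {b}) f \<and> (\<forall>d\<in>D - P. f d = M d) \<and> verts f (D - {b}) \<subseteq> V \<union> U"

text \<open>The colour \<open>b\<close> can be made the missing one by switches that only touch the colours in \<open>P\<close>
  and only use new vertices from \<open>U\<close>; at any one edge of \<open>P\<close> we may choose which end is left free.\<close>

definition reach :: "nat set \<Rightarrow> nat \<Rightarrow> 'a set \<Rightarrow> bool" where
  "reach P b U \<longleftrightarrow> b \<in> P \<and> P \<subseteq> D \<and> c\<^sub>0 \<in> P \<and> (\<exists>f. moved P b U f) \<and>
     (\<forall>p\<in>P - {c\<^sub>0}. \<forall>x\<in>ends (M p). \<exists>f. moved P b U f \<and> x \<notin> verts f (D - {b}))"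

lemma moved_mono: "moved P b U f \<Longrightarrow> U \<subseteq> U' \<Longrightarrow> moved P b U' f"
  unfolding moved_def by blast

lemma reach_mono: "reach P b U \<Longrightarrow> U \<subseteq> U' \<Longrightarrow> reach P b U'"
  unfolding reach_def by (meson moved_mono)

lemma reach_root: "reach {c\<^sub>0} c\<^sub>0 {}"
  using M c\<^sub>0 unfolding reach_def moved_def V_def by auto

lemma moved_switch:
  assumes f: "moved P b U f" and b: "b \<in> P"
    and a: "a \<in> D" "a \<notin> P" and e: "ends (M a) = {x, y}" "x \<noteq> y"
    and w: "(y, w) \<in> A b" "w \<notin> V" "w \<notin> U"
  shows "moved (insert a P) a (insert w U) (f(b := (y, w)))"
    and "verts (f(b := (y, w))) (D - {a}) \<subseteq> insert w (verts f (D - {b}) - {x})"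
proof -
  have fa: "f a = M a" "a \<noteq> b" using f a b unfolding moved_def by auto
  have w': "w \<notin> verts f (D - {b})" using f w unfolding moved_def by auto
  note sw = rainbow_switch[of A D b f a x y w]
  show *: "verts (f(b := (y, w))) (D - {a}) \<subseteq> insert w (verts f (D - {b}) - {x})"
    using sw(2) f fa e w w' a unfolding moved_def by simp
  show "moved (insert a P) a (insert w U) (f(b := (y, w)))"
    using sw(1) * f fa e w w' a b unfolding moved_def by auto
qed

lemma moved_stuck:
  assumes "moved P b U f" "b \<in> D" "(x, z) \<in> A b" "x \<noteq> z"
    "x \<notin> verts f (D - {b})" "z \<notin> verts f (D - {b})"
  shows False
  using rainbow_complete[of A D b f x z] no_rainbow assms unfolding moved_def by auto

text \<open>To free an end of the edge of \<open>a\<close>, the switch keeps the other end. For an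
  earlier edge, the switch starts from a state in which the end is already free; it stays free
  because only a vertex outside \<open>V\<close> is gained.\<close>

lemma reach_step:
  assumes r: "reach P b U" and a: "a \<in> D" "a \<notin> P" 
    and w: "\<And>v. v \<in> ends (M a) \<Longrightarrow> (v, w v) \<in> A b \<and> w v \<notin> V \<and> w v \<notin> U"
  shows "reach (insert a P) a (U \<union> w ` ends (M a))"
proof -
  have b: "b \<in> P" "c\<^sub>0 \<in> P" using r unfolding reach_def by auto
  then have ac: "a \<noteq> c\<^sub>0" using a by auto
  have step: "\<exists>f'. moved (insert a P) a (U \<union> w ` ends (M a)) f' \<and>
      verts f' (D - {a}) \<subseteq> insert (w y) (verts f (D - {b}) - {x})"
    if f: "moved P b U f" and e: "ends (M a) = {x, y}" "x \<noteq> y" for f x y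
  proof -
    have "(y, w y) \<in> A b" "w y \<notin> V" "w y \<notin> U" using w e by auto
    note s = moved_switch[OF f b(1) a e this]
    show ?thesis using s(2) moved_mono[OF s(1), of "U \<union> w ` ends (M a)"] e by blast
  qed
  have wV: "w v \<notin> V" if "v \<in> ends (M a)" for v using w that by blast
  have "fst (M a) \<in> ends (M a)" by (simp add: ends_def)
  then obtain x0 y0 where e0: "ends (M a) = {x0, y0}" "x0 \<noteq> y0"
    using obtain_ends[OF a(1) ac] by blast
  obtain f0 where f0: "moved P b U f0" using r unfolding reach_def by auto
  have "\<exists>f. moved (insert a P) a (U \<union> w ` ends (M a)) f" using step[OF f0 e0] by blast
  moreover have "\<exists>f. moved (insert a P) a (U \<union> w ` ends (M a)) f \<and> x \<notin> verts f (D - {a})"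
    if p: "p \<in> insert a P - {c\<^sub>0}" and x: "x \<in> ends (M p)" for p x
  proof (cases "p = a")
    case True
    obtain y where e: "ends (M a) = {x, y}" "x \<noteq> y" using obtain_ends[OF a(1) ac] x True by metis
    have "x \<noteq> w y" using wV e ends_subset_V[OF a(1) ac] by auto
    then show ?thesis using step[OF f0 e] by blast
  next
    case False
    then obtain f where f: "moved P b U f" "x \<notin> verts f (D - {b})"
      using r p x unfolding reach_def by blast
    have "p \<in> D" "p \<noteq> c\<^sub>0" using r p False unfolding reach_def by auto
    then have "x \<in> V" using ends_subset_V x by blast
    then have "x \<noteq> w y0" using wV e0 by auto
    then show ?thesis using step[OF f(1) e0] f(2) by blast
  qed
  ultimately show ?thesis using a b r unfolding reach_def by auto
qed

text \<open>\<open>H\<close> is a set of matched vertices that the missing colour \<open>b\<close> joins, via \<open>w\<close>, to distinct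
  fresh vertices. An edge with both ends in \<open>H\<close> can be switched out leaving either end free.\<close>

definition node :: "nat set \<Rightarrow> nat \<Rightarrow> 'a set \<Rightarrow> 'a set \<Rightarrow> ('a \<Rightarrow> 'a) \<Rightarrow> bool" where
  "node P b U H w \<longleftrightarrow> reach P b U \<and> H \<subseteq> V \<and> inj_on w H \<and>
     (\<forall>v\<in>H. (v, w v) \<in> A b \<and> w v \<notin> V \<and> w v \<notin> U)"

text \<open>If a vertex of \<open>H\<close> lay on the edge of \<open>p\<close>, some state would
  leave it free, and joining it to its fresh partner in colour \<open>b\<close> would complete the
  matching.\<close>

lemma node_disjoint:
  assumes n: "node P b U H w" and p: "p \<in> P" "p \<noteq> c\<^sub>0"
  shows "H \<inter> ends (M p) = {}"
proof (rule ccontr)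
  assume "H \<inter> ends (M p) \<noteq> {}"
  then obtain v where v: "v \<in> H" "v \<in> ends (M p)" by auto
  have r: "reach P b U" using n unfolding node_def by auto
  then obtain f where f: "moved P b U f" "v \<notin> verts f (D - {b})"
    using p v unfolding reach_def by blast
  have "(v, w v) \<in> A b" "w v \<notin> V" "w v \<notin> U" "v \<in> V" using n v unfolding node_def by auto
  moreover have "w v \<notin> verts f (D - {b})" using f calculation unfolding moved_def by auto
  moreover have "v \<noteq> w v" using calculation by auto
  moreover have "b \<in> D" using r unfolding reach_def by auto
  ultimately show False using moved_stuck[OF f(1)] f(2) by blast
qed

text \<open>Kernel vertices outside \<open>V \<union> U\<close> are pairwise inequivalent, as two
  equivalent ones would complete the matching. Hence their partners are distinct and lie in
  \<open>V \<union> U\<close>. The set \<open>U\<close> is charged twice: for kernel vertices in it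
  and for partners in it.\<close>

lemma reach_node:
  assumes r: "reach P b U" and U: "finite U" and k: "k \<le> card (equiv_kernel X (A b))"
  shows "\<exists>H w. node P b U H w \<and> k \<le> card H + card V + 2 * card U"
proof -
  have b: "b \<in> D" using r unfolding reach_def by auto
  note eq = equiv[OF b]
  have sym: "(y, x) \<in> A b" if "(x, y) \<in> A b" for x y using eq that by (meson equivE symE)
  have trans: "(x, z) \<in> A b" if "(x, y) \<in> A b" "(y, z) \<in> A b" for x y z
    using eq that by (meson equivE transE)
  obtain f where f: "moved P b U f" using r unfolding reach_def by auto
  define K where "K = equiv_kernel X (A b)"
  have finK: "finite K" unfolding K_def equiv_kernel_def using finite_X by auto
  have stuck: "x = z" if "(x, z) \<in> A b" "x \<notin> V \<union> U" "z \<notin> V \<union> U" for x z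
    using moved_stuck[OF f b that(1)] that f unfolding moved_def by blast
  define Z where "Z = K - (V \<union> U)"
  have "\<exists>y. (z, y) \<in> A b \<and> y \<noteq> z" if z: "z \<in> K" for z
  proof (rule ccontr)
    assume "\<not> ?thesis"
    then have "{y \<in> X. (z, y) \<in> A b} \<subseteq> {z}" by auto
    then have "card {y \<in> X. (z, y) \<in> A b} \<le> card {z}" by (intro card_mono) auto
    then show False using z unfolding K_def equiv_kernel_def by auto
  qed
  then obtain \<pi> where \<pi>: "(z, \<pi> z) \<in> A b" "\<pi> z \<noteq> z" if "z \<in> K" for z by metis
  have \<pi>VU: "\<pi> z \<in> V \<union> U" if "z \<in> Z" for z
    using stuck[of z "\<pi> z"] \<pi>[of z] that unfolding Z_def by auto
  have inj: "inj_on \<pi> Z"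
  proof (rule inj_onI)
    fix z z' assume z: "z \<in> Z" "z' \<in> Z" "\<pi> z = \<pi> z'"
    then have "(z, \<pi> z) \<in> A b" "(\<pi> z, z') \<in> A b" using sym[OF \<pi>(1)[of z']] \<pi>(1)[of z] unfolding Z_def by auto
    then have "(z, z') \<in> A b" by (rule trans)
    then show "z = z'" using stuck z unfolding Z_def by auto
  qed
  \<comment> \<open>Only partners in \<open>V\<close> are kept; there \<open>w\<close> inverts
    \<open>\<pi>\<close>, leading from a matched vertex back to its fresh kernel vertex.\<close>
  define Z' where "Z' = {z \<in> Z. \<pi> z \<in> V}"
  define w where "w = inv_into Z' \<pi>"
  have inj': "inj_on \<pi> Z'" using inj unfolding Z'_def inj_on_def by auto
  have wz: "w (\<pi> z) = z" if "z \<in> Z'" for z unfolding w_def using inj' that by simp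
  have finZ: "finite Z" unfolding Z_def using finK by auto
  have "node P b U (\<pi> ` Z') w"
    unfolding node_def
  proof (intro conjI ballI r)
    show "\<pi> ` Z' \<subseteq> V" unfolding Z'_def by auto
    show "inj_on w (\<pi> ` Z')" using wz by (auto intro!: inj_onI)
  next
    fix v assume "v \<in> \<pi> ` Z'"
    then obtain z where z: "z \<in> Z'" "v = \<pi> z" by auto
    then have "z \<in> K" "z \<notin> V" "z \<notin> U" unfolding Z'_def Z_def by auto
    then show "(v, w v) \<in> A b" "w v \<notin> V" "w v \<notin> U" using wz[OF z(1)] z(2) sym \<pi> by auto
  qed
  moreover have "k \<le> card (\<pi> ` Z') + card V + 2 * card U"
  proof -
    have "k \<le> card K" using k unfolding K_def .
    also have "\<dots> \<le> card Z + card (V \<union> U)"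
      unfolding Z_def using diff_card_le_card_Diff[of "V \<union> U" K] finite_V U by simp
    also have "card (V \<union> U) \<le> card V + card U" by (rule card_Un_le)
    also have "card Z \<le> card Z' + card (Z - Z')"
      using finZ card_Un_le[of Z' "Z - Z'"] unfolding Z'_def by (metis (no_types, lifting) Un_Diff_cancel Un_absorb1 mem_Collect_eq subsetI)
    also have "card (Z - Z') \<le> card U"
      using inj U \<pi>VU by (intro card_inj_on_le[of \<pi>]) (auto simp: Z'_def inj_on_def)
    also have "card Z' = card (\<pi> ` Z')" using inj' by (simp add: card_image)
    finally show ?thesis by simp
  qed
  ultimately show ?thesis by blast
qed

section \<open>Conflicts between switches in different orders\<close>

text \<open>Switch \<open>b\<close> onto \<open>y\<close>, then \<open>a\<close> onto
  \<open>p\<close>. Now \<open>c\<close> is missing and \<open>x\<close> is free, so joining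
  \<open>x\<close> to \<open>w3\<close> completes the matching unless \<open>w3\<close> is occupied;
  the hypotheses leave \<open>w1\<close> as the only obstacle.\<close>

lemma switch_conflict:
  assumes r: "reach P b U"
    and ac: "a \<in> D - P" "c \<in> D - P" "a \<noteq> c"
    and ends: "ends (M a) = {x, y}" "x \<noteq> y" "ends (M c) = {p, q}" "p \<noteq> q"
    and w1: "(y, w1) \<in> A b" "w1 \<notin> V" "w1 \<notin> U"
    and w2: "(p, w2) \<in> A a" "w2 \<notin> V" "w2 \<notin> U"
    and w3: "(x, w3) \<in> A c" "w3 \<notin> V" "w3 \<notin> U"
    and ne: "w1 \<noteq> w2" "w3 \<noteq> w2"
  shows "w3 = w1"
proof (rule ccontr)
  assume "w3 \<noteq> w1"
  obtain f where f: "moved P b U f" and b: "b \<in> P" "c\<^sub>0 \<in> P" using r unfolding reach_def by auto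
  have xV: "x \<in> V" using ends_subset_V[of a] ac b ends by auto
  note s1 = moved_switch[OF f b(1) _ _ ends(1,2) w1]
  have s1': "a \<in> D" "a \<notin> P" "c \<in> D" "c \<notin> insert a P" using ac by auto
  have e: "ends (M c) = {q, p}" "q \<noteq> p" using ends by auto
  have w2': "w2 \<notin> insert w1 U" using w2 ne by auto
  note s2 = moved_switch[OF s1(1)[OF s1'(1,2)] insertI1 s1'(3,4) e w2(1,2) w2']
  let ?f = "(f(b := (y, w1)))(a := (p, w2))"
  have "verts ?f (D - {c}) \<subseteq> insert w2 (insert w1 (verts f (D - {b}) - {x}))"
    using s2(2) s1(2)[OF s1'(1,2)] by blast
  moreover have "verts f (D - {b}) \<subseteq> V \<union> U" using f unfolding moved_def by auto
  ultimately have "x \<notin> verts ?f (D - {c})" "w3 \<notin> verts ?f (D - {c})"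
    using w1 w2 w3 xV ne \<open>w3 \<noteq> w1\<close> by auto
  then show False using moved_stuck[OF s2(1) s1'(3) w3(1)] xV w3 by auto
qed

text \<open>If \<open>a\<close> hits both ends of the edge of \<open>c\<close> and \<open>c\<close> hits the edge of \<open>a\<close>, then switching along
  \<open>a, c\<close> or along \<open>c, a\<close> completes the matching, unless the fresh vertices collide crosswise.\<close>

lemma swapped:
  assumes na: "node P b U H w" "a \<in> D - P" "ends (M a) \<subseteq> H"
    and nc: "node P' b' U' H' w'" "c \<in> D - P'" "ends (M c) \<subseteq> H'"
    and sub: "U \<subseteq> W" "U' \<subseteq> W"
    and ga: "node (insert a P) a (W \<union> w ` ends (M a)) G g"
    and gc: "node (insert c P') c (W \<union> w' ` ends (M c)) G' g'"
    and x: "x \<in> G'" "ends (M a) = {x, y}" "x \<noteq> y"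
    and pq: "ends (M c) \<subseteq> G" "ends (M c) = {p, q}" "p \<noteq> q"
  shows "a \<noteq> c" "c \<notin> P" "a \<notin> P'" "g' x = w y" "g q = w' p" "g p = w' q"
proof -
  have rP: "reach P b U" "reach P' b' U'" using na nc unfolding node_def by auto
  then have c0: "a \<noteq> c\<^sub>0" "c \<noteq> c\<^sub>0" using na nc unfolding reach_def by auto
  show acP: "a \<noteq> c" "c \<notin> P" "a \<notin> P'"
    using node_disjoint[OF ga, of c] node_disjoint[OF gc, of a] x pq c0 by auto
  have W: "(x, w x) \<in> A b" "(y, w y) \<in> A b" "w x \<notin> V" "w y \<notin> V" "w x \<notin> U" "w y \<notin> U"
    using na x unfolding node_def by auto
  have W': "(p, w' p) \<in> A b'" "(q, w' q) \<in> A b'" "w' p \<notin> V" "w' q \<notin> V" "w' p \<notin> U'" "w' q \<notin> U'"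
    using nc pq unfolding node_def by auto
  have G: "(p, g p) \<in> A a" "(q, g q) \<in> A a" "g p \<notin> V" "g q \<notin> V" "g p \<notin> W" "g q \<notin> W"
    "g p \<noteq> w x" "g p \<noteq> w y" "g q \<noteq> w x" "g q \<noteq> w y"
    using ga pq x unfolding node_def by auto
  have gpq: "g p \<noteq> g q" using ga pq unfolding node_def inj_on_def by auto
  have G': "(x, g' x) \<in> A c" "g' x \<notin> V" "g' x \<notin> W" "g' x \<noteq> w' p" "g' x \<noteq> w' q"
    using gc pq x unfolding node_def by auto
  have aDP: "a \<in> D - P" "c \<in> D - P" "a \<in> D - P'" "c \<in> D - P'" using na nc acP by auto
  have pq': "ends (M c) = {q, p}" "q \<noteq> p" using pq by auto
  show eq: "g' x = w y"
  \<comment> \<open>Either end of the edge of \<open>c\<close> can be taken by \<open>a\<close>: if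
    \<open>g' x\<close> equals \<open>g p\<close>, it differs from \<open>g q\<close> by
    injectivity.\<close>
  proof (cases "g' x = g p")
    case False
    then show ?thesis
      using switch_conflict[OF rP(1) aDP(1,2) acP(1) x(2,3) pq(2,3), of "w y" "g p" "g' x"] W G G' sub
      by auto
  next
    case True
    then show ?thesis
      using switch_conflict[OF rP(1) aDP(1,2) acP(1) x(2,3) pq', of "w y" "g q" "g' x"] W G G' sub gpq
      by auto
  qed
  \<comment> \<open>The roles of \<open>a\<close> and \<open>c\<close> are now exchanged. By
    \<open>eq\<close>, \<open>g' x\<close> is \<open>w y\<close>, a vertex that \<open>g\<close>
    avoids.\<close>
  show "g q = w' p"
    using switch_conflict[OF rP(2) aDP(4,3) acP(1)[symmetric] pq' x(2,3), of "w' p" "g' x" "g q"]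
      W' G G' sub eq by auto
  show "g p = w' q"
    using switch_conflict[OF rP(2) aDP(4,3) acP(1)[symmetric] pq(2,3) x(2,3), of "w' q" "g' x" "g p"]
      W' G G' sub eq by auto
qed

text \<open>Two crosswise collisions below the same parent \<open>b\<close> are excluded by switching \<open>b, a, c, a'\<close> and
  finishing at the end \<open>q\<close> of the edge of \<open>c\<close> that the second switch left free.\<close>

lemma swapped_unique:
  assumes n: "node P b U H w"
    and a: "a \<in> D - P" "ends (M a) \<subseteq> H" and a': "a' \<in> D - P" "ends (M a') \<subseteq> H"
    and nc: "node P' b' U' H' w'" "c \<in> D - P'" "ends (M c) \<subseteq> H'"
    and sub: "U \<subseteq> W" "U' \<subseteq> W"
    and ga: "node (insert a P) a (W \<union> w ` ends (M a)) G\<^sub>a g\<^sub>a"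
    and ga': "node (insert a' P) a' (W \<union> w ` ends (M a')) G\<^sub>a' g\<^sub>a'"
    and gc: "node (insert c P') c (W \<union> w' ` ends (M c)) G\<^sub>c g\<^sub>c"
    and bad: "ends (M c) \<subseteq> G\<^sub>a" "G\<^sub>c \<inter> ends (M a) \<noteq> {}"
    and bad': "ends (M c) \<subseteq> G\<^sub>a'" "G\<^sub>c \<inter> ends (M a') \<noteq> {}"
  shows "a = a'"
proof (rule ccontr)
  assume aa': "a \<noteq> a'"
  have r: "reach P b U" and b: "b \<in> P" "c\<^sub>0 \<in> P" using n unfolding node_def reach_def by auto
  obtain f where f: "moved P b U f" using r unfolding reach_def by auto
  have c0: "a \<noteq> c\<^sub>0" "a' \<noteq> c\<^sub>0" "c \<noteq> c\<^sub>0" using a a' nc b unfolding node_def reach_def by auto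
  obtain x where x: "x \<in> G\<^sub>c" "x \<in> ends (M a)" using bad(2) by auto
  obtain y where xy: "x \<in> G\<^sub>c" "ends (M a) = {x, y}" "x \<noteq> y"
    using obtain_ends[OF _ c0(1) x(2)] a x(1) by (metis DiffE)
  obtain x' where x': "x' \<in> G\<^sub>c" "x' \<in> ends (M a')" using bad'(2) by auto
  obtain y' where xy': "x' \<in> G\<^sub>c" "ends (M a') = {x', y'}" "x' \<noteq> y'"
    using obtain_ends[OF _ c0(2) x'(2)] a' x'(1) by (metis DiffE)
  have "fst (M c) \<in> ends (M c)" by (simp add: ends_def)
  from obtain_ends[OF _ c0(3) this] obtain p q where pq: "ends (M c) = {p, q}" "p \<noteq> q"
    using nc(2) by (metis DiffE)
  note sw = swapped[OF n a nc sub ga gc xy bad(1) pq]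
  note sw' = swapped[OF n a' nc sub ga' gc xy' bad'(1) pq]
  have V: "x \<in> V" "y \<in> V" "x' \<in> V" "y' \<in> V" "p \<in> V" "q \<in> V"
    using ends_subset_V[of a] ends_subset_V[of a'] ends_subset_V[of c] a a' nc c0 xy xy' pq by auto
  have disj: "ends (M a) \<inter> ends (M a') = {}"
    using M a a' aa' c0 unfolding rainbow_def by auto
  have W: "(y, w y) \<in> A b" "w y \<notin> V" "w y \<notin> U" "w y' \<notin> V" "w y' \<notin> U"
    using n a a' xy xy' unfolding node_def by auto
  have wyy': "w y \<noteq> w y'"
    using n a a' xy xy' disj unfolding node_def inj_on_def by auto
  have wpq: "w' p \<noteq> w' q" using nc pq unfolding node_def inj_on_def by auto
  \<comment> \<open>Both collisions force the same partners: \<open>p\<close> goes to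
    \<open>w' q\<close> and \<open>q\<close> to \<open>w' p\<close>. So \<open>a\<close> can use the
    first pair and \<open>a'\<close> the second without a clash.\<close>
  have G: "(p, w' q) \<in> A a" "w' q \<notin> V" "w' q \<notin> U" "w' q \<noteq> w y"
      "(q, w' p) \<in> A a'" "w' p \<notin> V" "w' p \<notin> U" "w' p \<noteq> w y"
    and G2: "w' q \<noteq> w y'" "w' p \<noteq> w y'"
    using ga ga' bad bad' pq xy xy' sub sw(5,6)[symmetric] sw'(5,6)[symmetric]
    unfolding node_def by auto
  have Gc: "(x', w y') \<in> A c" using gc xy' sw'(4)[symmetric] unfolding node_def by auto
  have mem: "a \<in> D" "a \<notin> P" "c \<in> D" "c \<notin> insert a P" "a' \<in> D" "a' \<notin> insert c (insert a P)"
    using a a' nc sw(1,2) sw'(1,2) aa' by auto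
  note s1 = moved_switch[OF f b(1) mem(1,2) xy(2,3) W(1-3)]
  have e: "ends (M c) = {q, p}" "q \<noteq> p" using pq by auto
  have u: "w' q \<notin> insert (w y) U" using G by auto
  note s2 = moved_switch[OF s1(1) insertI1 mem(3,4) e G(1,2) u]
  have e': "ends (M a') = {y', x'}" "y' \<noteq> x'" using xy' by auto
  have u': "w y' \<notin> insert (w' q) (insert (w y) U)" using G2 W wyy' by auto
  note s3 = moved_switch[OF s2(1) insertI1 mem(5,6) e' Gc W(4) u']
  let ?f = "((f(b := (y, w y)))(a := (p, w' q)))(c := (x', w y'))"
  \<comment> \<open>The second switch freed \<open>q\<close>, and the third gains only a vertex
    outside \<open>V\<close>.\<close>
  have "q \<notin> verts ?f (D - {a'})"
  proof -
    have "q \<notin> verts ((f(b := (y, w y)))(a := (p, w' q))) (D - {c})"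
      by (intro contra_subsetD[OF s2(2)]) (use G(2) V(6) in auto)
    then show ?thesis by (intro contra_subsetD[OF s3(2)]) (use W(4) V(6) in auto)
  qed
  moreover have "w' p \<notin> verts f (D - {b})" using f G(6,7) unfolding moved_def by auto
  then have "w' p \<notin> verts (f(b := (y, w y))) (D - {a})"
    by (intro contra_subsetD[OF s1(2)]) (use G(8) in simp)
  then have "w' p \<notin> verts ((f(b := (y, w y)))(a := (p, w' q))) (D - {c})"
    by (intro contra_subsetD[OF s2(2)]) (use wpq in simp)
  then have "w' p \<notin> verts ?f (D - {a'})"
    by (intro contra_subsetD[OF s3(2)]) (use G2(2) in simp)
  moreover have "q \<noteq> w' p" using V(6) G(6) by auto
  ultimately show False using moved_stuck[OF s3(1) mem(5) G(5)] by blast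
qed

section \<open>The tree of reached colours and its edge count\<close>

definition child :: "nat \<Rightarrow> nat set \<times> nat \<times> 'a set \<times> 'a set \<times> ('a \<Rightarrow> 'a) \<Rightarrow> bool" where
  "child a t \<longleftrightarrow> (case t of (P, b, U, H, w) \<Rightarrow> a \<in> D - P \<and> ends (M a) \<subseteq> H)"

text \<open>No tree shape is stored: each reached colour only needs some node from which its edge
  can be switched. The number of nodes will bound the collisions.\<close>

definition tree :: "(nat set \<times> nat \<times> 'a set \<times> 'a set \<times> ('a \<Rightarrow> 'a)) set \<Rightarrow> nat set \<Rightarrow> 'a set \<Rightarrow> bool" where
  "tree T R W \<longleftrightarrow> finite T \<and> finite W \<and> R \<subseteq> D - {c\<^sub>0} \<and>
     (\<forall>(P, b, U, H, w)\<in>T. node P b U H w \<and> U \<subseteq> W) \<and> (\<forall>a\<in>R. \<exists>t\<in>T. child a t)"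

text \<open>\<open>G\<close> is counted edge by edge: outside \<open>R\<close> an edge contributes
  at most 1, and one more if both ends lie in \<open>G\<close>. Having \<open>card R\<close> on the
  left avoids subtraction of naturals.\<close>

lemma card_le_children:
  assumes n: "node P b U G g" and R: "R \<subseteq> D - {c\<^sub>0}"
  shows "card G + card R \<le> (\<Sum>a\<in>R. card (G \<inter> ends (M a))) + (card D - 1)
    + card {a \<in> D - {c\<^sub>0} - R. ends (M a) \<subseteq> G}"
proof -
  let ?D = "D - {c\<^sub>0}" and ?h = "\<lambda>a. card (G \<inter> ends (M a))"
  have fin: "finite ?D" "finite R" "finite (?D - R)" using finite_D R finite_subset by auto
  have "G = (\<Union>a\<in>?D. G \<inter> ends (M a))"
    using n unfolding node_def V_def verts_def by auto
  then have "card G \<le> (\<Sum>a\<in>?D. ?h a)" using card_UN_le[OF fin(1)] by metis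
  also have "\<dots> = (\<Sum>a\<in>?D - R. ?h a) + (\<Sum>a\<in>R. ?h a)"
    using sum.subset_diff[OF R fin(1)] .
  also have "(\<Sum>a\<in>?D - R. ?h a) \<le> (\<Sum>a\<in>?D - R. 1 + of_bool (ends (M a) \<subseteq> G))"
  proof (rule sum_mono)
    fix a
    have le: "?h a \<le> card (ends (M a))" "card (ends (M a)) \<le> 2"
      by (auto intro: card_mono card_ends_le)
    show "?h a \<le> 1 + of_bool (ends (M a) \<subseteq> G)"
    proof (cases "ends (M a) \<subseteq> G")
      case False
      then have "G \<inter> ends (M a) \<subset> ends (M a)" by auto
      then have "?h a < card (ends (M a))" by (intro psubset_card_mono) auto
      then show ?thesis using le by simp
    qed (use le in auto)
  qed
  also have "\<dots> = card (?D - R) + card {a \<in> ?D - R. ends (M a) \<subseteq> G}"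
    unfolding sum.distrib using fin(3) by (simp add: sum_of_bool_eq Int_def)
  also have "card (?D - R) = card D - 1 - card R"
    using fin R c\<^sub>0 finite_D by (simp add: card_Diff_subset card_Diff_singleton)
  finally have "card G \<le> card D - 1 - card R + card {a \<in> ?D - R. ends (M a) \<subseteq> G} + (\<Sum>a\<in>R. ?h a)" by simp
  moreover have "card R \<le> card D - 1"
    using card_mono[OF fin(1) R] c\<^sub>0 finite_D by (simp add: card_Diff_singleton)
  ultimately show ?thesis by simp
qed

text \<open>Of the three multiples of \<open>card D - 1\<close>, two account for \<open>V\<close>
  and one for single hits.\<close>

lemma tree_start:
  assumes "k \<le> card (equiv_kernel X (A c\<^sub>0))"
  shows "\<exists>t R. tree {t} R {} \<and> k \<le> 3 * (card D - 1) + card R"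
proof -
  obtain H w where n: "node {c\<^sub>0} c\<^sub>0 {} H w" and H: "k \<le> card H + card V"
    using reach_node[OF reach_root _ assms] by auto
  let ?R = "{a \<in> D - {c\<^sub>0} - {}. ends (M a) \<subseteq> H}"
  have "tree {({c\<^sub>0}, c\<^sub>0, {}, H, w)} ?R {}"
    using n unfolding tree_def child_def by auto
  moreover have "k \<le> 3 * (card D - 1) + card ?R"
    using card_le_children[OF n, of "{}"] H card_V_le by simp
  ultimately show ?thesis by blast
qed

end

section \<open>Averaging over the hits inside the reached set\<close>

text \<open>Double counting over ordered pairs: at most \<open>card R * t\<close> pairs are bad, so
  an average row sums to at most \<open>card R + 2 * t\<close>.\<close>

lemma exists_small_row:
  fixes h :: "'b \<Rightarrow> 'b \<Rightarrow> nat"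
  assumes R: "finite R" "R \<noteq> {}"
    and h: "\<And>a c. a \<in> R \<Longrightarrow> c \<in> R \<Longrightarrow> h c a + h a c \<le> 2 + 2 * of_bool (bad a c) + 2 * of_bool (bad c a)"
    and bad: "\<And>c. c \<in> R \<Longrightarrow> card {a \<in> R. bad a c} \<le> t"
  shows "\<exists>c\<in>R. (\<Sum>a\<in>R. h c a) \<le> card R + 2 * t"
proof (rule ccontr)
  assume "\<not> ?thesis"
  then have big: "card R + 2 * t < (\<Sum>a\<in>R. h c a)" if "c \<in> R" for c using that by auto
  let ?S = "\<Sum>c\<in>R. \<Sum>a\<in>R. h c a" and ?B = "\<Sum>c\<in>R. \<Sum>a\<in>R. of_bool (bad a c) :: nat"
  have "card R * (card R + 2 * t) < ?S"
    using sum_strict_mono[OF R big] by simp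
  moreover have "2 * ?S \<le> 2 * (card R * card R) + 4 * ?B"
  proof -
    have "2 * ?S = (\<Sum>c\<in>R. \<Sum>a\<in>R. h c a + h a c)"
      using sum.swap[of h R R] by (simp add: sum.distrib)
    also have "\<dots> \<le> (\<Sum>c\<in>R. \<Sum>a\<in>R. 2 + 2 * of_bool (bad a c) + 2 * of_bool (bad c a))"
      by (intro sum_mono h)
    also have "\<dots> = 2 * (card R * card R) + 2 * ?B + 2 * (\<Sum>c\<in>R. \<Sum>a\<in>R. of_bool (bad c a))"
      unfolding sum.distrib by (simp add: sum_distrib_left)
    also have "(\<Sum>c\<in>R. \<Sum>a\<in>R. of_bool (bad c a) :: nat) = ?B"
      by (rule sum.swap)
    finally show ?thesis by simp
  qed
  moreover have "?B \<le> card R * t"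
  proof -
    have "?B = (\<Sum>c\<in>R. card {a \<in> R. bad a c})"
      using R by (simp add: sum_of_bool_eq Int_def)
    also have "\<dots> \<le> card R * t" using sum_bounded_above[of R _ t] bad by simp
    finally show ?thesis .
  qed
  ultimately show False by (simp add: algebra_simps)
qed

section \<open>Growth of the tree\<close>

context near_matching
begin

text \<open>Every colour of \<open>R\<close> yields a candidate node. One with few hits inside
  \<open>R\<close> is added, as its other hits must cover many edges outside \<open>R\<close> at
  both ends.\<close>

lemma tree_grow:
  assumes T: "tree T R W" and R: "R \<noteq> {}"
    and k: "\<And>d. d \<in> D \<Longrightarrow> k \<le> card (equiv_kernel X (A d))"
  shows "\<exists>t R' W'. tree (insert t T) (R \<union> R') W' \<and> card W' \<le> card W + 2 \<and> R \<inter> R' = {} \<and>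
    k \<le> 3 * (card D - 1) + card R' + 2 * card T + 2 * card W + 4"
proof -
  have finT: "finite T" "finite W" and RD: "R \<subseteq> D - {c\<^sub>0}" using T unfolding tree_def by auto
  have finR: "finite R" using RD finite_D finite_subset by blast
  obtain par where par: "par a \<in> T" "child a (par a)" if "a \<in> R" for a
    using T unfolding tree_def by metis
  obtain P b U H w where tup: "par a = (P a, b a, U a, H a, w a)" for a
  proof -
    have "par a = (fst (par a), fst (snd (par a)), fst (snd (snd (par a))),
        fst (snd (snd (snd (par a)))), snd (snd (snd (snd (par a)))))" for a by simp
    then show thesis by (rule that)
  qed
  have n: "node (P a) (b a) (U a) (H a) (w a)" "U a \<subseteq> W" "a \<in> D - P a" "ends (M a) \<subseteq> H a"
    if "a \<in> R" for a
    using par[OF that] T tup[of a] unfolding tree_def child_def by auto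
  \<comment> \<open>All of \<open>W\<close> is excluded, not just \<open>U a\<close>, so that the
    fresh vertices of one colour also avoid those used on the way to another, as
    \<open>swapped\<close> requires.\<close>
  define Q where "Q a = W \<union> w a ` ends (M a)" for a
  have Q: "finite (Q a)" "card (Q a) \<le> card W + 2" for a
  proof -
    show "finite (Q a)" unfolding Q_def using finT by simp
    have "card (Q a) \<le> card W + card (w a ` ends (M a))" unfolding Q_def by (rule card_Un_le)
    also have "card (w a ` ends (M a)) \<le> 2"
      using card_image_le[of "ends (M a)" "w a"] card_ends_le[of "M a"] by simp
    finally show "card (Q a) \<le> card W + 2" by simp
  qed
  have "\<exists>G g. node (insert a (P a)) a (Q a) G g \<and> k \<le> card G + card V + 2 * card (Q a)"
    if a: "a \<in> R" for a
  proof -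
    have "reach (insert a (P a)) a (U a \<union> w a ` ends (M a))"
      using n[OF a] unfolding node_def by (intro reach_step[of _ "b a"]) auto
    then have "reach (insert a (P a)) a (Q a)"
      by (rule reach_mono) (use n[OF a] Q_def in auto)
    then show ?thesis by (rule reach_node) (use Q k a RD in auto)
  qed
  then obtain G g where
    G: "node (insert a (P a)) a (Q a) (G a) (g a)" "k \<le> card (G a) + card V + 2 * card (Q a)"
    if "a \<in> R" for a by metis
  define bad where "bad a c \<longleftrightarrow> ends (M c) \<subseteq> G a \<and> G c \<inter> ends (M a) \<noteq> {}" for a c
  define h where "h c a = card (G c \<inter> ends (M a))" for c a
  have h_le: "h c a \<le> 2" for c a
    unfolding h_def using card_mono[of "ends (M a)" "G c \<inter> ends (M a)"] card_ends_le[of "M a"] by simp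
  have h_2: "ends (M a) \<subseteq> G c" if "h c a = 2" for c a
  proof -
    have "G c \<inter> ends (M a) = ends (M a)"
      using that card_ends_le[of "M a"] unfolding h_def by (intro card_seteq) auto
    then show ?thesis by auto
  qed
  have h_0: "G c \<inter> ends (M a) \<noteq> {}" if "h c a \<noteq> 0" for c a using that unfolding h_def by auto
  have hh: "h c a + h a c \<le> 2 + 2 * of_bool (bad a c) + 2 * of_bool (bad c a)" for a c
  proof (cases "bad a c \<or> bad c a")
    case True
    then show ?thesis using h_le[of c a] h_le[of a c] by auto
  next
    case False
    \<comment> \<open>Without a collision, two hits in one direction exclude any in the
      other.\<close>
    then have "h a c = 2 \<longrightarrow> h c a = 0" "h c a = 2 \<longrightarrow> h a c = 0"
      unfolding bad_def using h_2 h_0 by blast+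
    then show ?thesis using h_le[of c a] h_le[of a c] by auto
  qed
  \<comment> \<open>By \<open>swapped_unique\<close> each parent node has at most one child that
    collides with \<open>c\<close>.\<close>
  have bad_card: "card {a \<in> R. bad a c} \<le> card T" if c: "c \<in> R" for c
  proof (rule card_inj_on_le[of par])
    show "inj_on par {a \<in> R. bad a c}"
    proof (rule inj_onI)
      fix a a' assume a: "a \<in> {a \<in> R. bad a c}" "a' \<in> {a \<in> R. bad a c}" and eq: "par a = par a'"
      then have aR: "a \<in> R" "a' \<in> R" and ba: "bad a c" "bad a' c" by auto
      have same: "P a' = P a" "H a' = H a" "w a' = w a" using eq tup by auto
      show "a = a'"
        using swapped_unique[OF n(1,3,4)[OF aR(1)] n(3,4)[OF aR(2), unfolded same] n(1,3,4)[OF c]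
          n(2)[OF aR(1)] n(2)[OF c] G(1)[OF aR(1), unfolded Q_def]
          G(1)[OF aR(2), unfolded Q_def same] G(1)[OF c, unfolded Q_def]] ba
        unfolding bad_def by blast
    qed
  qed (use par finT in auto)
  obtain c where c: "c \<in> R" "(\<Sum>a\<in>R. h c a) \<le> card R + 2 * card T"
    using exists_small_row[OF finR R hh bad_card] by blast
  let ?t = "(insert c (P c), c, Q c, G c, g c)"
  let ?R = "{a \<in> D - {c\<^sub>0} - R. ends (M a) \<subseteq> G c}"
  have "child a ?t" if "a \<in> ?R" for a
  proof -
    have "a \<notin> insert c (P c)"
      using node_disjoint[OF G(1)[OF c(1)], of a] that ends_nonempty[of "M a"] by blast
    then show ?thesis using that unfolding child_def by auto
  qed
  then have "tree (insert ?t T) (R \<union> ?R) (Q c)"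
    using T G(1)[OF c(1)] Q(1) unfolding tree_def by (fastforce simp: Q_def)
  moreover have "k \<le> 3 * (card D - 1) + card ?R + 2 * card T + 2 * card W + 4"
    using card_le_children[OF G(1)[OF c(1)] RD] c(2) G(2)[OF c(1)] Q(2)[of c] card_V_le
    unfolding h_def by linarith
  moreover have "R \<inter> ?R = {}" by auto
  ultimately show ?thesis using Q(2)[of c] by blast
qed

text \<open>Each round adds at least \<open>L / 2\<close> colours to \<open>R\<close>, so after
  \<open>L div 12\<close> rounds \<open>R\<close> would be larger than \<open>N\<close>.\<close>

lemma kernels_small:
  assumes N: "card D \<le> N" and L: "144 * N \<le> L * L"
    and ker: "\<And>d. d \<in> D \<Longrightarrow> 3 * N + L \<le> card (equiv_kernel X (A d))"
  shows False
proof -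
  have "card D > 0" using c\<^sub>0 finite_D by (auto simp: card_gt_0_iff)
  then have L0: "L > 0" using N L by (cases L) auto
  have grow: "12 * n \<le> L \<Longrightarrow>
      \<exists>T R W. tree T R W \<and> card T \<le> n + 1 \<and> card W \<le> 2 * n \<and> (n + 1) * L \<le> 2 * card R" for n
  proof (induction n)
    case 0
    obtain t R where t: "tree {t} R {}" and R: "3 * N + L \<le> 3 * (card D - 1) + card R"
      using tree_start[OF ker[OF c\<^sub>0]] by blast
    have "(0 + 1) * L \<le> 2 * card R" using R N by simp
    then show ?case using t by (intro exI[of _ "{t}"] exI[of _ R] exI[of _ "{}"]) auto
  next
    case (Suc n)
    then obtain T R W where T: "tree T R W" "card T \<le> n + 1" "card W \<le> 2 * n" "(n + 1) * L \<le> 2 * card R"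
      by auto
    have "R \<noteq> {}" using T(4) L0 by auto
    then obtain t R' W' where t: "tree (insert t T) (R \<union> R') W'" "card W' \<le> card W + 2" "R \<inter> R' = {}"
      and k: "3 * N + L \<le> 3 * (card D - 1) + card R' + 2 * card T + 2 * card W + 4"
      using tree_grow[OF T(1) _ ker] by blast
    have "R \<union> R' \<subseteq> D" "finite T" using t(1) unfolding tree_def by auto
    then have "card (R \<union> R') = card R + card R'"
      using t(3) finite_subset[OF _ finite_D] by (intro card_Un_disjoint) auto
    moreover have "card D - 1 + 1 \<le> N" using N \<open>card D > 0\<close> by simp
    \<comment> \<open>The loss \<open>2 * card T + 2 * card W + 4\<close> is at most
      \<open>6 * (n + 1)\<close>, hence at most \<open>L / 2\<close>; this is the origin of the
      factor 12.\<close>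
    then have "L \<le> 2 * card R'" using k T Suc.prems by simp
    moreover have "card (insert t T) \<le> Suc n + 1"
      using T(2) \<open>finite T\<close> by (simp add: card_insert_if)
    ultimately show ?case using t T
      by (intro exI[of _ "insert t T"] exI[of _ "R \<union> R'"] exI[of _ W']) auto
  qed
  obtain T R W where T: "tree T R W" "(L div 12 + 1) * L \<le> 2 * card R"
    using grow[of "L div 12"] by auto
  have "card R \<le> card D" using T(1) finite_D unfolding tree_def by (intro card_mono) auto
  have "L * L < (12 * (L div 12 + 1)) * L" using L0 by (intro mult_strict_right_mono) auto
  also have "\<dots> = 12 * ((L div 12 + 1) * L)" by (rule mult.assoc)
  also have "\<dots> \<le> 12 * (2 * card R)" using T(2) by (rule mult_le_mono2)
  finally show False using L \<open>card R \<le> card D\<close> N by linarith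
qed

end

section \<open>Induction on the colours and the theorem\<close>

text \<open>The bounds refer to a fixed \<open>N\<close> instead of \<open>card D\<close>, so they
  pass to smaller colour sets in the induction.\<close>

lemma rainbow_exists:
  assumes "finite X" "finite D" "card D \<le> N" "144 * N \<le> L * L"
    and "\<And>d. d \<in> D \<Longrightarrow> equiv X (A d)"
    and "\<And>d. d \<in> D \<Longrightarrow> 3 * N + L \<le> card (equiv_kernel X (A d))"
  shows "\<exists>f. rainbow A D f"
  using assms(2,3,5,6)
proof (induction D rule: finite_induct)
  case empty
  then show ?case by (simp add: rainbow_def)
next
  case (insert c D)
  then obtain M where M: "rainbow A D M" by auto
  show ?case
  proof (rule ccontr)
    assume "\<not> ?thesis"
    then interpret near_matching X A "insert c D" c M
      using assms(1) insert M by unfold_locales auto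
    show False using kernels_small[of N L] insert assms(4) by auto
  qed
qed

theorem theorem1p2:
  fixes \<delta> :: real and n :: nat and X :: "'a set" and A :: "nat \<Rightarrow> ('a \<times> 'a) set"
  assumes "\<delta> > 0"
    and "real n \<ge> 144 / \<delta>\<^sup>2"
    and "finite X"
    and "\<And>i. i \<in> {1..n} \<Longrightarrow> equiv X (A i)"
    and "\<And>i. i \<in> {1..n} \<Longrightarrow> real (card (equiv_kernel X (A i))) \<ge> (3 + \<delta>) * real n"
  shows "has_rainbow_matching X n A"
proof -
  \<comment> \<open>Kernel sizes are integers, so their lower bound survives rounding
    \<open>\<delta> * n\<close> up.\<close>
  define L where "L = nat \<lceil>\<delta> * n\<rceil>"
  have L: "\<delta> * n \<le> L" unfolding L_def by (rule real_nat_ceiling_ge)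
  have "144 \<le> n * \<delta>\<^sup>2" using assms(1,2) by (simp add: field_simps)
  then have "144 * real n \<le> (\<delta> * n) * (\<delta> * n)"
    using mult_right_mono[of 144 "n * \<delta>\<^sup>2" "real n"] by (simp add: power2_eq_square algebra_simps)
  also have "\<dots> \<le> real L * real L" using L assms(1) by (intro mult_mono) auto
  finally have "real (144 * n) \<le> real (L * L)" by simp
  then have LL: "144 * n \<le> L * L" by (simp only: of_nat_le_iff)
  have ker: "3 * n + L \<le> card (equiv_kernel X (A i))" if "i \<in> {1..n}" for i
  proof -
    have "\<delta> * n \<le> real_of_int (int (card (equiv_kernel X (A i))) - 3 * int n)"
      using assms(5)[OF that] by (simp add: algebra_simps)
    then have "\<lceil>\<delta> * n\<rceil> \<le> int (card (equiv_kernel X (A i))) - 3 * int n"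
      by (simp add: ceiling_le_iff)
    moreover have "0 \<le> \<delta> * n" using assms(1) by simp
    then have "0 \<le> \<lceil>\<delta> * n\<rceil>" by linarith
    ultimately show ?thesis unfolding L_def by linarith
  qed
  have "\<exists>f. rainbow A {1..n} f"
    by (rule rainbow_exists[OF assms(3) _ _ LL assms(4) ker]) auto
  then obtain f where f: "rainbow A {1..n} f" by blast
  have "f i \<in> X \<times> X" if "i \<in> {1..n}" for i
    using f that equiv_type[OF assms(4)[OF that]] unfolding rainbow_def by blast
  then have X: "fst (f i) \<in> X" "snd (f i) \<in> X" if "i \<in> {1..n}" for i
    using that by (simp_all add: mem_Times_iff)
  have disj: "ends (f i) \<inter> ends (f j) = {}" if "i \<in> {1..n}" "j \<in> {1..n}" "i \<noteq> j" for i j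
    using f that unfolding rainbow_def by blast
  have "i = j" if "i \<in> {1..n}" "j \<in> {1..n}" "v \<in> ends (f i)" "v \<in> ends (f j)" for i j v
    using disj[OF that(1,2)] that(3,4) by blast
  then have "inj_on (\<lambda>i. fst (f i)) {1..n}" "inj_on (\<lambda>i. snd (f i)) {1..n}"
    unfolding ends_def inj_on_def by (metis insertI1, metis insertI1 insertI2)
  moreover have "fst (f i) \<noteq> snd (f j)" if "i \<in> {1..n}" "j \<in> {1..n}" for i j
    using f that disj[of i j] unfolding ends_def rainbow_def by (cases "i = j") auto
  then have "(\<lambda>i. fst (f i)) ` {1..n} \<inter> (\<lambda>i. snd (f i)) ` {1..n} = {}" by blast
  moreover have "(fst (f i), snd (f i)) \<in> A i" if "i \<in> {1..n}" for i
    using f that unfolding rainbow_def by simp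
  ultimately show ?thesis unfolding has_rainbow_matching_def
    by (intro exI[of _ "\<lambda>i. fst (f i)"] exI[of _ "\<lambda>i. snd (f i)"] conjI ballI X)
qed

end
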